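(* Let $N$ be a non-negative integer, $k$ an integer, and $\nu\in\{0,1\}$. Let $$GSC_{2N+\nu,2}(k,q) := \sum_{\substack{\pi\in\mathcal{SCP}\\ \mathrm{GBG}^{(2)}(\pi)=k\\ l(\pi)\le 2N+\nu}} q^{|\pi|}$$ be the generating function for self-conjugate partitions with all parts at most $2N+\nu$ and GBG-rank mod $2$ equal to $k$. Then $$GSC_{2N+\nu,2}(k,q) = q^{2k^2-k}\left[\begin{matrix}2N+\nu\\ N+k\end{matrix}\right]_{q^4}.$$
   Context: A partition is a non-increasing finite sequence $\pi=(\lambda_1,\lambda_2,\ldots)$ of positive integers (its parts); the empty partition is included. $|\pi|=\sum_i\lambda_i$ is its norm, and $l(\pi)$ is its largest part ($0$ for the empty partition). The Young diagram of $\pi$ has $\lambda_i$ cells in row $i$, left-justified. The conjugate $\pi'$ is the partition whose Young diagram is the reflection of that of $\pi$ across the main diagonal; $\pi$ is self-conjugate if $\pi=\pi'$, and $\mathcal{SCP}$ is the set of all self-conjugate partitions. For a positive integer $t$, the cell in row $i$ and column $j$ ($i,j\ge1$) is labeled by the least non-negative integer congruent to $j-i$ modulo $t$. For $0\le s\le t-1$, $r_s(\pi,t)$ is the number of cells of $\pi$ labeled $s$. With $\omega_t=e^{2\pi\sqrt{-1}/t}$, the GBG-rank of $\pi$ mod $t$ is $\mathrm{GBG}^{(t)}(\pi)=\sum_{s=0}^{t-1} r_s(\pi,t)\,\omega_t^s$; in particular, for $t=2$, $\mathrm{GBG}^{(2)}(\pi)=r_0(\pi,2)-r_1(\pi,2)$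 (the BG-rank). For $L\ge0$, $(a;q)_L=\prod_{m=0}^{L-1}(1-aq^m)$. The $q$-binomial coefficient is $\left[\begin{matrix}m\\ n\end{matrix}\right]_q=\frac{(q;q)_m}{(q;q)_n(q;q)_{m-n}}$ for $m\ge n\ge0$ and $0$ otherwise; the subscript $q^4$ means $q$ is replaced by $q^4$. *)

theory Defs
  imports "HOL-Analysis.Analysis" "HOL-Computational_Algebra.Formal_Power_Series"
begin

definition is_partition :: "nat list \<Rightarrow> bool" where
  "is_partition \<pi> \<longleftrightarrow> sorted_wrt (\<ge>) \<pi> \<and> (\<forall>x\<in>set \<pi>. 0 < x)"

definition largest_part :: "nat list \<Rightarrow> nat" where
  "largest_part \<pi> = Max (insert 0 (set \<pi>))"

text \<open>Rows and columns are numbered from 1, list positions from 0.\<close>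

definition young_diagram :: "nat list \<Rightarrow> (nat \<times> nat) set" where
  "young_diagram \<pi> = {(i, j). 1 \<le> i \<and> i \<le> length \<pi> \<and> 1 \<le> j \<and> j \<le> \<pi> ! (i - 1)}"

text \<open>Existence and uniqueness of \<open>\<sigma>\<close> are shown in \<open>ex1_conjugate\<close> below.\<close>

definition conjugate :: "nat list \<Rightarrow> nat list" where
  "conjugate \<pi> =
     (THE \<sigma>. is_partition \<sigma> \<and> young_diagram \<sigma> = prod.swap ` young_diagram \<pi>)"

definition SCP :: "nat list set" where
  "SCP = {\<pi>. is_partition \<pi> \<and> conjugate \<pi> = \<pi>}"

text \<open>On \<^typ>\<open>int\<close>, \<open>mod\<close> by a positive number yields the least non-negative residue.\<close>

definition cell_label :: "nat \<Rightarrow> nat \<times> nat \<Rightarrow> nat" where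
  "cell_label t = (\<lambda>(i, j). nat ((int j - int i) mod int t))"

definition label_count :: "nat \<Rightarrow> nat list \<Rightarrow> nat \<Rightarrow> nat" where
  "label_count s \<pi> t = card {c \<in> young_diagram \<pi>. cell_label t c = s}"

definition GBG :: "nat \<Rightarrow> nat list \<Rightarrow> complex" where
  "GBG t \<pi> = (\<Sum>s<t. of_nat (label_count s \<pi> t) * exp (2 * of_real pi * \<i> / of_nat t) ^ s)"

text \<open>The sum is over a finite set, see \<open>finite_SCP_bounded\<close> below.\<close>

definition GSC :: "nat \<Rightarrow> nat \<Rightarrow> complex \<Rightarrow> 'a \<Rightarrow> 'a :: comm_semiring_1" where
  "GSC L t k q = (\<Sum>\<pi> | \<pi> \<in> SCP \<and> GBG t \<pi> = k \<and> largest_part \<pi> \<le> L. q ^ sum_list \<pi>)"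

definition q_pochhammer :: "'a \<Rightarrow> 'a \<Rightarrow> nat \<Rightarrow> 'a :: comm_ring_1" where
  "q_pochhammer a q L = (\<Prod>m<L. 1 - a * q ^ m)"

text \<open>
  For power series \<open>q\<close> with zero constant term the denominator has constant term 1, so over a
  field the division is multiplication by its inverse.
\<close>

definition q_binomial :: "int \<Rightarrow> int \<Rightarrow> 'a \<Rightarrow> 'a :: idom_divide" where
  "q_binomial m n q =
     (if 0 \<le> n \<and> n \<le> m
      then q_pochhammer q q (nat m) div
             (q_pochhammer q q (nat n) * q_pochhammer q q (nat (m - n)))
      else 0)"


lemma mem_young_diagram:
  "(i, j) \<in> young_diagram \<pi> \<longleftrightarrow> 1 \<le> i \<and> i \<le> length \<pi> \<and> 1 \<le> j \<and> j \<le> \<pi> ! (i - 1)"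
  by (simp add: young_diagram_def)

lemma is_partition_nth_mono:
  assumes "is_partition \<pi>" "i \<le> j" "j < length \<pi>"
  shows "\<pi> ! j \<le> \<pi> ! i"
  using assms unfolding is_partition_def
  by (cases "i = j") (auto simp: sorted_wrt_iff_nth_less)

lemma young_diagram_row:
  "{j. (Suc i, j) \<in> young_diagram \<pi>} = (if i < length \<pi> then {1..\<pi> ! i} else {})"
  by (auto simp: mem_young_diagram)

lemma length_eq_card_young_diagram:
  assumes "is_partition \<pi>"
  shows "length \<pi> = card {i. (i, 1) \<in> young_diagram \<pi>}"
proof -
  have "\<pi> ! (i - 1) \<ge> 1" if "1 \<le> i" "i \<le> length \<pi>" for i
  proof -
    have "\<pi> ! (i - 1) \<in> set \<pi>" using that by (intro nth_mem) auto
    then show ?thesis using assms by (auto simp: is_partition_def Suc_le_eq)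
  qed
  then have "{i. (i, 1) \<in> young_diagram \<pi>} = {1..length \<pi>}"
    by (auto simp: mem_young_diagram)
  then show ?thesis by simp
qed

lemma young_diagram_inj:
  assumes "is_partition \<pi>" "is_partition \<sigma>" "young_diagram \<pi> = young_diagram \<sigma>"
  shows "\<pi> = \<sigma>"
proof (rule nth_equalityI)
  show len: "length \<pi> = length \<sigma>"
    using assms by (simp add: length_eq_card_young_diagram)
  fix i assume "i < length \<pi>"
  then show "\<pi> ! i = \<sigma> ! i"
    using young_diagram_row[of i \<pi>] young_diagram_row[of i \<sigma>] assms(3) len
    by (metis card_atLeastAtMost diff_Suc_1 One_nat_def)
qed

lemma ex1_conjugate:
  assumes "is_partition \<pi>"
  shows "\<exists>!\<sigma>. is_partition \<sigma> \<and> young_diagram \<sigma> = prod.swap ` young_diagram \<pi>"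
proof -
  define c where "c j = length (filter (\<lambda>x. j \<le> x) \<pi>)" for j
  define \<sigma> where "\<sigma> = map c [1..<Suc (largest_part \<pi>)]"
  have c_card: "c j = card {i. i < length \<pi> \<and> j \<le> \<pi> ! i}" for j
    by (simp add: c_def length_filter_conv_card)
  have c_iff: "i < c j \<longleftrightarrow> i < length \<pi> \<and> j \<le> \<pi> ! i" for i j
  proof
    assume *: "i < length \<pi> \<and> j \<le> \<pi> ! i"
    have "{..i} \<subseteq> {i. i < length \<pi> \<and> j \<le> \<pi> ! i}"
      using * is_partition_nth_mono[OF assms] by (auto intro: order_trans)
    from card_mono[OF _ this] show "i < c j" by (simp add: c_card)
  next
    assume *: "i < c j"
    show "i < length \<pi> \<and> j \<le> \<pi> ! i"
    proof (rule ccontr)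
      assume n: "\<not> ?thesis"
      have "{i. i < length \<pi> \<and> j \<le> \<pi> ! i} \<subseteq> {..<i}"
      proof
        fix m assume m: "m \<in> {i. i < length \<pi> \<and> j \<le> \<pi> ! i}"
        show "m \<in> {..<i}"
        proof (rule ccontr)
          assume "m \<notin> {..<i}"
          then have "i \<le> m" by simp
          with m is_partition_nth_mono[OF assms, of i m] n show False by auto
        qed
      qed
      from card_mono[OF _ this] * show False by (simp add: c_card)
    qed
  qed
  have largest: "\<pi> ! i \<le> largest_part \<pi>" if "i < length \<pi>" for i
    unfolding largest_part_def using that by (intro Max_ge) auto
  have ex: "\<exists>i < length \<pi>. j \<le> \<pi> ! i" if "1 \<le> j" "j \<le> largest_part \<pi>" for j
  proof -
    have "largest_part \<pi> \<in> insert 0 (set \<pi>)"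
      unfolding largest_part_def by (intro Max_in) auto
    with that have "largest_part \<pi> \<in> set \<pi>" by auto
    then show ?thesis using that by (metis in_set_conv_nth)
  qed
  have anti: "c j \<le> c i" if "i \<le> j" for i j
    unfolding c_card using that by (intro card_mono) auto
  have nth: "\<sigma> ! j = c (Suc j)" if "j < largest_part \<pi>" for j
    using that unfolding \<sigma>_def by (subst nth_map) (auto simp del: upt_Suc)
  have len: "length \<sigma> = largest_part \<pi>" by (simp add: \<sigma>_def)
  have "is_partition \<sigma>"
    unfolding is_partition_def
  proof (intro conjI ballI)
    show "sorted_wrt (\<ge>) \<sigma>"
      by (auto simp: sorted_wrt_iff_nth_less len nth intro: anti)
    fix x assume "x \<in> set \<sigma>"
    then obtain j where j: "1 \<le> j" "j \<le> largest_part \<pi>" "x = c j"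
      unfolding \<sigma>_def by (auto simp del: upt_Suc)
    with ex[of j] c_iff[of _ j] show "0 < x" by (metis gr0I not_less0)
  qed
  moreover have "young_diagram \<sigma> = prod.swap ` young_diagram \<pi>"
  proof -
    have "(j, i) \<in> young_diagram \<sigma> \<longleftrightarrow> (i, j) \<in> young_diagram \<pi>" for i j
    proof (cases "1 \<le> i \<and> 1 \<le> j")
      case True
      then obtain i' j' where ij: "i = Suc i'" "j = Suc j'"
        by (metis One_nat_def Suc_le_D)
      have "(j, i) \<in> young_diagram \<sigma> \<longleftrightarrow> j' < largest_part \<pi> \<and> i' < c j"
        using nth by (auto simp: ij mem_young_diagram len Suc_le_eq)
      also have "\<dots> \<longleftrightarrow> i' < length \<pi> \<and> j \<le> \<pi> ! i'"
        using largest[of i'] by (auto simp: c_iff ij)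
      also have "\<dots> \<longleftrightarrow> (i, j) \<in> young_diagram \<pi>"
        by (auto simp: ij mem_young_diagram)
      finally show ?thesis .
    qed (auto simp: mem_young_diagram)
    then show ?thesis by force
  qed
  ultimately show ?thesis
    by (metis young_diagram_inj)
qed

lemma SCP_iff:
  "\<pi> \<in> SCP \<longleftrightarrow> is_partition \<pi> \<and> prod.swap ` young_diagram \<pi> = young_diagram \<pi>"
proof
  assume "\<pi> \<in> SCP"
  then show "is_partition \<pi> \<and> prod.swap ` young_diagram \<pi> = young_diagram \<pi>"
    using theI'[OF ex1_conjugate[of \<pi>]] unfolding SCP_def conjugate_def by force
next
  assume *: "is_partition \<pi> \<and> prod.swap ` young_diagram \<pi> = young_diagram \<pi>"
  then have "conjugate \<pi> = \<pi>"
    unfolding conjugate_def by (intro the1_equality ex1_conjugate) auto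
  with * show "\<pi> \<in> SCP" by (simp add: SCP_def)
qed

lemma finite_SCP_bounded: "finite {\<pi> \<in> SCP. largest_part \<pi> \<le> L}"
proof (rule finite_subset)
  show "finite {\<pi>. set \<pi> \<subseteq> {..L} \<and> length \<pi> \<le> L}"
    by (rule finite_lists_length_le) simp
  show "{\<pi> \<in> SCP. largest_part \<pi> \<le> L} \<subseteq> {\<pi>. set \<pi> \<subseteq> {..L} \<and> length \<pi> \<le> L}"
  proof (clarify, intro conjI)
    fix \<pi> assume \<pi>: "\<pi> \<in> SCP" "largest_part \<pi> \<le> L"
    have le: "x \<le> L" if "x \<in> set \<pi>" for x
      using that \<pi>(2) by (auto simp: largest_part_def)
    then show "set \<pi> \<subseteq> {..L}" by auto
    have "is_partition \<pi>" and sym: "prod.swap ` young_diagram \<pi> = young_diagram \<pi>"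
      using \<pi>(1) by (auto simp: SCP_iff)
    show "length \<pi> \<le> L"
    proof (cases "\<pi> = []")
      case False
      have "1 \<le> \<pi> ! (length \<pi> - 1)"
        using \<open>is_partition \<pi>\<close> False by (simp add: is_partition_def Suc_le_eq)
      then have "(length \<pi>, 1) \<in> young_diagram \<pi>"
        using False by (auto simp: mem_young_diagram Suc_le_eq)
      then have "(1, length \<pi>) \<in> young_diagram \<pi>"
        by (subst sym[symmetric]) force
      then have "length \<pi> \<le> \<pi> ! 0" by (simp add: mem_young_diagram)
      also have "\<dots> \<le> L" using False by (intro le) simp
      finally show ?thesis .
    qed simp
  qed
qed

text \<open>The exponent is passed through \<^const>\<open>nat\<close>, which is faithful by non-negativity.\<close>

lemma exponent_nonneg: "0 \<le> 2 * k ^ 2 - (k :: int)"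
proof -
  have "k \<le> k ^ 2" by (cases "k \<le> 0") (auto simp: power2_eq_square intro: order_trans)
  then show ?thesis using zero_le_power2[of k] by linarith
qed

end

theory Submission imports Defs begin

text \<open>
  A non-empty self-conjugate partition with largest part \<open>L + 1\<close> is a self-conjugate partition with
  parts at most \<open>L\<close>, shifted along the diagonal, together with its principal hook. The hook has
  \<open>2 * L + 1\<close> cells and contributes \<open>(- 1) ^ L\<close> to the BG-rank, while the diagonal shift preserves
  labels. So the generating function satisfies
  \<open>G (L + 1) k = G L k + q ^ (2 * L + 1) * G L (k - (- 1) ^ L)\<close>, and for even and odd \<open>L\<close>
  this is one of the two \<open>q\<close>-Pascal rules in base \<open>q ^ 4\<close>.
\<close>

section \<open>The \<open>q\<close>-Pascal rules\<close>

lemma q_pochhammer_Suc: "q_pochhammer a q (Suc n) = q_pochhammer a q n * (1 - a * q ^ n)"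
  by (simp add: q_pochhammer_def)

lemma q_pochhammer_nth_0:
  fixes a q :: "'a :: comm_ring_1 fps"
  assumes "fps_nth a 0 = 0"
  shows "fps_nth (q_pochhammer a q n) 0 = 1"
  using assms by (induction n) (simp_all add: q_pochhammer_Suc, simp add: q_pochhammer_def)

text \<open>The denominator has constant term 1, hence is a unit among power series and the division
  is exact. This trades quotients for products, so that identities between \<open>q_binomial\<close>
  terms follow by cancellation.\<close>

lemma q_binomial_mult_pochhammer:
  fixes Q :: "'a :: field fps"
  assumes "fps_nth Q 0 = 0"
  shows "q_binomial (int (m + n)) (int n) Q * (q_pochhammer Q Q n * q_pochhammer Q Q m) =
           q_pochhammer Q Q (m + n)"
proof -
  have "is_unit (q_pochhammer Q Q n * q_pochhammer Q Q m)"
    using assms by (simp add: q_pochhammer_nth_0)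
  then have "q_pochhammer Q Q n * q_pochhammer Q Q m dvd q_pochhammer Q Q (m + n)"
    by (rule unit_imp_dvd)
  moreover have "nat (int (m + n) - int n) = m" by simp
  ultimately show ?thesis
    by (simp only: q_binomial_def nat_int dvd_div_mult_self) simp
qed

lemma q_binomial_symmetric: "q_binomial m (m - n) q = q_binomial m n q"
  by (auto simp: q_binomial_def mult.commute)

lemma q_binomial_0_right:
  fixes Q :: "'a :: field fps"
  assumes "fps_nth Q 0 = 0"
  shows "q_binomial (int m) 0 Q = 1"
proof -
  have "q_pochhammer Q Q m \<noteq> 0"
    using q_pochhammer_nth_0[OF assms, of Q m] by auto
  with q_binomial_mult_pochhammer[OF assms, of m 0] show ?thesis
    by (simp add: q_pochhammer_def)
qed

text \<open>Rests on \<open>1 - Q ^ (m + 1) = (1 - Q ^ (m + 1 - n)) + Q ^ (m + 1 - n) * (1 - Q ^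
  n)\<close>, multiplied by \<open>q_pochhammer Q Q m\<close>. Allowing every integer
  \<open>n\<close> spares the final induction any range conditions.\<close>

lemma q_binomial_pascal:
  fixes Q :: "'a :: field fps"
  assumes "fps_nth Q 0 = 0"
  shows "q_binomial (int (Suc m)) n Q =
           q_binomial (int m) n Q + Q ^ nat (int m + 1 - n) * q_binomial (int m) (n - 1) Q"
proof (cases "1 \<le> n \<and> n \<le> int m")
  case True
  define r where "r = nat (n - 1)"
  define d where "d = nat (int m - n)"
  have n: "n = int (Suc r)" and m: "m = Suc (d + r)"
    using True by (auto simp: r_def d_def)
  let ?P = "q_pochhammer Q Q"
  let ?B = "\<lambda>m n. q_binomial (int m) (int n) Q"
  let ?D = "?P (Suc r) * ?P (Suc d)"
  have nz: "?D \<noteq> 0"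
    using q_pochhammer_nth_0[OF assms, of Q "Suc r"] q_pochhammer_nth_0[OF assms, of Q "Suc d"]
    by auto
  have "?B (Suc m) (Suc r) * ?D = ?P (Suc m)"
    using q_binomial_mult_pochhammer[OF assms, of "Suc d" "Suc r"] by (simp add: m)
  \<comment> \<open>The last factor \<open>1 - Q ^ Suc m\<close> is split; here
    \<open>Suc m = Suc d + Suc r\<close>.\<close>
  also have "\<dots> = ?P m * ((1 - Q * Q ^ d) + Q ^ Suc d * (1 - Q * Q ^ r))"
    by (simp add: q_pochhammer_Suc m algebra_simps power_add)
  also have "\<dots> = ?P m * (1 - Q * Q ^ d) + Q ^ Suc d * (?P m * (1 - Q * Q ^ r))"
    by (simp only: distrib_left mult.left_commute)
  also have "?P m = ?B m (Suc r) * (?P (Suc r) * ?P d)"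
    using q_binomial_mult_pochhammer[OF assms, of d "Suc r"] by (simp add: m)
  also have "\<dots> * (1 - Q * Q ^ d) = ?B m (Suc r) * ?D"
    by (simp only: q_pochhammer_Suc mult_ac)
  \<comment> \<open>The copy of \<open>?P m\<close> in the second summand is factored differently,
    so that \<open>1 - Q * Q ^ r\<close> completes \<open>?P r\<close> to
    \<open>?P (Suc r)\<close>.\<close>
  also have "?B m (Suc r) * (?P (Suc r) * ?P d) = ?B m r * (?P r * ?P (Suc d))"
    using q_binomial_mult_pochhammer[OF assms, of d "Suc r"]
      q_binomial_mult_pochhammer[OF assms, of "Suc d" r] by (simp add: m)
  also have "\<dots> * (1 - Q * Q ^ r) = ?B m r * ?D"
    by (simp only: q_pochhammer_Suc mult_ac)
  finally have "?B (Suc m) (Suc r) * ?D = (?B m (Suc r) + Q ^ Suc d * ?B m r) * ?D"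
    by (simp only: distrib_right mult.assoc)
  then have "?B (Suc m) (Suc r) = ?B m (Suc r) + Q ^ Suc d * ?B m r"
    by (simp only: mult_right_cancel[OF nz])
  moreover have "nat (int m + 1 - n) = Suc d" "n - 1 = int r"
    by (auto simp: n m)
  ultimately show ?thesis by (simp only: n)
next
  case False
  \<comment> \<open>At \<open>n = 0\<close> and \<open>n = m + 1\<close> exactly one term on the
    right survives and equals 1. Beyond these all three coefficients vanish, so a truncated exponent
    does no harm.\<close>
  then consider "n < 0" | "n = 0" | "n = int m + 1" | "n > int m + 1" by linarith
  then show ?thesis
  proof cases
    case 2
    then show ?thesis
      using q_binomial_0_right[OF assms, of m] q_binomial_0_right[OF assms, of "Suc m"]
      by (simp add: q_binomial_def)
  next
    case 3
    then show ?thesis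
      using q_binomial_0_right[OF assms, of m] q_binomial_0_right[OF assms, of "Suc m"]
        q_binomial_symmetric[of "int m" 0 Q] q_binomial_symmetric[of "int (Suc m)" 0 Q]
      by (simp add: q_binomial_def add.commute)
  qed (auto simp: q_binomial_def)
qed

text \<open>The reflection of the first rule under \<open>n\<close> to
  \<open>m + 1 - n\<close>.\<close>

lemma q_binomial_pascal':
  fixes Q :: "'a :: field fps"
  assumes "fps_nth Q 0 = 0"
  shows "q_binomial (int (Suc m)) n Q =
           q_binomial (int m) (n - 1) Q + Q ^ nat n * q_binomial (int m) n Q"
  using q_binomial_pascal[OF assms, of m "int (Suc m) - n"]
    q_binomial_symmetric[of "int (Suc m)" n Q] q_binomial_symmetric[of "int m" "n - 1" Q]
    q_binomial_symmetric[of "int m" n Q]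
  by (simp add: algebra_simps)

section \<open>The BG-rank\<close>

lemma finite_young_diagram: "finite (young_diagram \<pi>)"
proof -
  have "young_diagram \<pi> = (\<Union>i\<in>{1..length \<pi>}. {i} \<times> {1..\<pi> ! (i - 1)})"
    by (auto simp: young_diagram_def)
  then show ?thesis by simp
qed

text \<open>An integer-valued form of the rank, defined on arbitrary cell sets so that it can be
  split over a hook and the shifted rest. The sum \<open>i + j\<close> has the parity of
  \<open>j - i\<close> and avoids subtraction on naturals.\<close>

definition bg_rank :: "(nat \<times> nat) set \<Rightarrow> int" where
  "bg_rank D = (\<Sum>(i, j)\<in>D. (- 1) ^ (i + j))"

lemma cell_label_2: "cell_label 2 (i, j) = (if even (i + j) then 0 else 1)"
proof -
  have "(int j - int i) mod 2 = (if even (i + j) then 0 else 1)"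
    by (simp add: mod_2_eq_odd)
  then show ?thesis by (simp add: cell_label_def)
qed

text \<open>The primitive root is -1 for \<open>t = 2\<close>, so the rank is the number of cells
  with \<open>i + j\<close> even minus the number with \<open>i + j\<close> odd.\<close>

lemma GBG_2: "GBG 2 \<pi> = of_int (bg_rank (young_diagram \<pi>))"
proof -
  let ?D = "young_diagram \<pi>"
  have count: "int (label_count s \<pi> 2) = (\<Sum>c\<in>?D. if cell_label 2 c = s then 1 else 0)" for s
    by (simp add: label_count_def finite_young_diagram flip: sum.inter_filter)
  have "exp (2 * of_real pi * \<i> / of_nat 2) = - 1"
    by (simp add: exp_Euler mult.commute)
  then have "GBG 2 \<pi> = of_int (int (label_count 0 \<pi> 2) - int (label_count 1 \<pi> 2))"
    unfolding GBG_def by (simp add: numeral_2_eq_2)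
  also have "int (label_count 0 \<pi> 2) - int (label_count 1 \<pi> 2) = bg_rank ?D"
    unfolding count sum_subtractf[symmetric] bg_rank_def
    by (intro sum.cong) (auto simp: cell_label_2 split: if_splits)
  finally show ?thesis .
qed

section \<open>Adding a principal hook\<close>

definition principal_hook :: "nat \<Rightarrow> (nat \<times> nat) set" where
  "principal_hook L = {1} \<times> {1..Suc L} \<union> {1..Suc L} \<times> {1}"

text \<open>Lengthening arm and leg by one adds two cells of sign \<open>- ((- 1) ^ L)\<close>,
  which turns \<open>(- 1) ^ L\<close> into its negative.\<close>

lemma bg_rank_principal_hook: "bg_rank (principal_hook L) = (- 1) ^ L"
proof (induction L)
  case 0
  then show ?case by (simp add: bg_rank_def principal_hook_def)
next
  case (Suc L)
  have "principal_hook (Suc L) =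
      insert (1, Suc (Suc L)) (insert (Suc (Suc L), 1) (principal_hook L))"
    by (auto simp: principal_hook_def)
  moreover have "finite (principal_hook L)" by (simp add: principal_hook_def)
  moreover have "(1, Suc (Suc L)) \<notin> principal_hook L" "(Suc (Suc L), 1) \<notin> principal_hook L"
    by (auto simp: principal_hook_def)
  ultimately show ?case using Suc by (simp add: bg_rank_def)
qed

text \<open>The row lengths after a diagonal shift and insertion of the hook: old rows gain a first
  cell, and ones extend the first column to \<open>Suc L\<close> rows. The truncated subtraction is
  faithful when \<open>length \<pi> \<le> L\<close>.\<close>

definition add_hook :: "nat \<Rightarrow> nat list \<Rightarrow> nat list" where
  "add_hook L \<pi> = Suc L # map Suc \<pi> @ replicate (L - length \<pi>) 1"

lemma sum_list_map_Suc: "sum_list (map Suc xs) = sum_list xs + length xs"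
  by (induction xs) auto

lemma sum_list_add_hook:
  "length \<pi> \<le> L \<Longrightarrow> sum_list (add_hook L \<pi>) = 2 * L + 1 + sum_list \<pi>"
  by (simp add: add_hook_def sum_list_map_Suc sum_list_replicate)

lemma length_add_hook: "length \<pi> \<le> L \<Longrightarrow> length (add_hook L \<pi>) = Suc L"
  by (simp add: add_hook_def)

lemma young_diagram_add_hook:
  assumes "length \<pi> \<le> L"
  shows "young_diagram (add_hook L \<pi>) =
           principal_hook L \<union> map_prod Suc Suc ` young_diagram \<pi>"
proof -
  have "(i, j) \<in> young_diagram (add_hook L \<pi>) \<longleftrightarrow>
      (i, j) \<in> principal_hook L \<or> (\<exists>i' j'. i = Suc i' \<and> j = Suc j' \<and> (i', j') \<in> young_diagram \<pi>)"
    for i j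
  proof (cases "2 \<le> i \<and> 2 \<le> j")
    case True
    then obtain i' j' where ij: "i = Suc (Suc i')" "j = Suc (Suc j')"
      by (metis add_2_eq_Suc le_Suc_ex)
    show ?thesis
      using assms
      by (auto simp: ij principal_hook_def mem_young_diagram length_add_hook)
        (auto simp: add_hook_def nth_append split: if_splits)
  next
    case False
    then consider "i = 0" | "j = 0" | "i = 1" | "j = 1" "i \<ge> 2" by linarith
    then show ?thesis
    proof cases
      case 4
      then obtain i' where i: "i = Suc (Suc i')" by (metis add_2_eq_Suc le_Suc_ex)
      show ?thesis
        using assms 4
        by (auto simp: i principal_hook_def mem_young_diagram length_add_hook)
          (auto simp: add_hook_def nth_append)
    qed (use assms in \<open>auto simp: principal_hook_def mem_young_diagram length_add_hook add_hook_def\<close>)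
  qed
  then show ?thesis
    by (auto simp: map_prod_def image_iff split_beta) force
qed

lemma principal_hook_Int_shift: "principal_hook L \<inter> map_prod Suc Suc ` young_diagram \<pi> = {}"
  by (auto simp: principal_hook_def mem_young_diagram)

text \<open>Reads the inner diagram back off the enlarged one; both the transfer of symmetry and
  injectivity use this.\<close>

lemma shift_mem_young_diagram_add_hook:
  assumes "length \<pi> \<le> L"
  shows "(i, j) \<in> young_diagram \<pi> \<longleftrightarrow>
           1 \<le> i \<and> 1 \<le> j \<and> (Suc i, Suc j) \<in> young_diagram (add_hook L \<pi>)"
  by (auto simp: young_diagram_add_hook[OF assms] principal_hook_def mem_young_diagram)

text \<open>The shift raises \<open>i + j\<close> by 2 and so keeps every sign; the hook is disjoint
  from the shifted diagram.\<close>

lemma bg_rank_add_hook: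
  assumes "length \<pi> \<le> L"
  shows "bg_rank (young_diagram (add_hook L \<pi>)) = (- 1) ^ L + bg_rank (young_diagram \<pi>)"
proof -
  have "bg_rank (map_prod Suc Suc ` young_diagram \<pi>) = bg_rank (young_diagram \<pi>)"
    unfolding bg_rank_def
    by (subst sum.reindex) (auto intro!: prod.inj_map inj_on_subset[OF prod.inj_map] sum.cong)
  moreover have "bg_rank (young_diagram (add_hook L \<pi>)) =
      bg_rank (principal_hook L) + bg_rank (map_prod Suc Suc ` young_diagram \<pi>)"
    unfolding young_diagram_add_hook[OF assms] bg_rank_def
    by (intro sum.union_disjoint principal_hook_Int_shift)
      (auto simp: principal_hook_def finite_young_diagram)
  ultimately show ?thesis by (simp add: bg_rank_principal_hook)
qed

section \<open>Hook addition as a bijection on self-conjugate partitions\<close>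

lemma largest_part_le_iff: "largest_part \<pi> \<le> L \<longleftrightarrow> (\<forall>x\<in>set \<pi>. x \<le> L)"
  by (auto simp: largest_part_def)

lemma largest_part_Cons:
  assumes "is_partition (x # xs)"
  shows "largest_part (x # xs) = x"
  using assms by (auto simp: largest_part_def is_partition_def intro!: Max_eqI)

text \<open>Reflection exchanges the first column with the first row. Thus a bound on the parts also
  supplies the length bound that \<open>add_hook\<close> needs.\<close>

lemma length_eq_largest_part:
  assumes "\<pi> \<in> SCP"
  shows "length \<pi> = largest_part \<pi>"
proof (cases \<pi>)
  case Nil
  then show ?thesis by (simp add: largest_part_def)
next
  case (Cons x xs)
  have part: "is_partition \<pi>" and sym: "prod.swap ` young_diagram \<pi> = young_diagram \<pi>"
    using assms by (auto simp: SCP_iff)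
  have "(i, 1) \<in> young_diagram \<pi> \<longleftrightarrow> (1, i) \<in> young_diagram \<pi>" for i
    by (subst sym[symmetric]) (force simp: image_iff)
  then have "length \<pi> = card {i. (1, i) \<in> young_diagram \<pi>}"
    by (simp add: length_eq_card_young_diagram[OF part])
  also have "{i. (1, i) \<in> young_diagram \<pi>} = {1..x}"
    using Cons by (auto simp: mem_young_diagram)
  finally show ?thesis using largest_part_Cons part Cons by simp
qed

lemma is_partition_add_hook:
  assumes "is_partition \<pi>" "largest_part \<pi> \<le> L"
  shows "is_partition (add_hook L \<pi>)"
proof -
  have "sorted_wrt (\<ge>) (replicate n x)" for n and x :: nat
    by (simp add: sorted_wrt_iff_nth_less)
  with assms show ?thesis
    by (auto simp: is_partition_def add_hook_def largest_part_le_iff sorted_wrt_append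
        sorted_wrt_map)
qed

text \<open>The hook is itself symmetric and the diagonal shift commutes with reflection, so
  symmetry passes in both directions.\<close>

lemma swap_young_diagram_add_hook_iff:
  assumes "length \<pi> \<le> L"
  shows "prod.swap ` young_diagram (add_hook L \<pi>) = young_diagram (add_hook L \<pi>) \<longleftrightarrow>
           prod.swap ` young_diagram \<pi> = young_diagram \<pi>"
proof -
  have swap_iff: "prod.swap ` D = D \<longleftrightarrow> (\<forall>i j. (i, j) \<in> D \<longleftrightarrow> (j, i) \<in> D)"
    for D :: "(nat \<times> nat) set"
    by (force simp: set_eq_iff image_iff)
  have hook: "(i, j) \<in> principal_hook L \<longleftrightarrow> (j, i) \<in> principal_hook L" for i j
    by (auto simp: principal_hook_def)
  show ?thesis
    unfolding swap_iff
  proof (rule iffI; intro allI)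
    fix i j
    assume "\<forall>i j. (i, j) \<in> young_diagram \<pi> \<longleftrightarrow> (j, i) \<in> young_diagram \<pi>"
    then show "(i, j) \<in> young_diagram (add_hook L \<pi>) \<longleftrightarrow> (j, i) \<in> young_diagram (add_hook L \<pi>)"
      using hook[of i j] by (auto simp: young_diagram_add_hook[OF assms])
  next
    fix i j
    assume "\<forall>i j. (i, j) \<in> young_diagram (add_hook L \<pi>) \<longleftrightarrow> (j, i) \<in> young_diagram (add_hook L \<pi>)"
    then show "(i, j) \<in> young_diagram \<pi> \<longleftrightarrow> (j, i) \<in> young_diagram \<pi>"
      by (auto simp: shift_mem_young_diagram_add_hook[OF assms])
  qed
qed

lemma add_hook_in_SCP:
  assumes "\<pi> \<in> SCP" "largest_part \<pi> \<le> L"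
  shows "add_hook L \<pi> \<in> SCP" "largest_part (add_hook L \<pi>) = Suc L"
proof -
  have "length \<pi> \<le> L" using assms length_eq_largest_part by simp
  then show SCP: "add_hook L \<pi> \<in> SCP"
    using assms by (simp add: SCP_iff swap_young_diagram_add_hook_iff is_partition_add_hook)
  show "largest_part (add_hook L \<pi>) = Suc L"
    using SCP \<open>length \<pi> \<le> L\<close> length_eq_largest_part length_add_hook by metis
qed

text \<open>The preimage arises by deleting the first row and the first column.\<close>

lemma add_hook_surj:
  assumes "\<pi> \<in> SCP" "largest_part \<pi> = Suc L"
  obtains \<sigma> where "\<sigma> \<in> SCP" "largest_part \<sigma> \<le> L" "\<pi> = add_hook L \<sigma>"
proof -
  have part: "is_partition \<pi>" and len: "length \<pi> = Suc L"
    using assms length_eq_largest_part by (auto simp: SCP_iff)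
  then obtain x \<tau> where \<pi>: "\<pi> = x # \<tau>" by (cases \<pi>) auto
  with part assms have x: "x = Suc L" using largest_part_Cons by simp
  have len\<tau>: "length \<tau> = L" using len \<pi> by simp
  have sorted: "sorted_wrt (\<ge>) \<tau>" and pos: "\<forall>y\<in>set \<tau>. 0 < y" and le: "\<forall>y\<in>set \<tau>. y \<le> Suc L"
    using part \<pi> x by (auto simp: is_partition_def)
  \<comment> \<open>Since \<open>\<tau>\<close> is non-increasing, the rows that survive deletion of
    the first column form a prefix.\<close>
  define \<rho> where "\<rho> = takeWhile (\<lambda>y. 1 < y) \<tau>"
  define \<sigma> where "\<sigma> = map (\<lambda>y. y - 1) \<rho>"
  have \<rho>_mem: "y \<in> set \<tau> \<and> 1 < y" if "y \<in> set \<rho>" for y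
    using that set_takeWhileD unfolding \<rho>_def by fastforce
  have len\<sigma>: "length \<sigma> \<le> L"
    using length_takeWhile_le[of "\<lambda>y. 1 < y" \<tau>] by (simp add: \<sigma>_def \<rho>_def len\<tau>)
  \<comment> \<open>After the first row of length at most 1, monotonicity and positivity leave only
    ones; these are the padding in \<open>add_hook\<close>.\<close>
  have "\<forall>y\<in>set (dropWhile (\<lambda>y. 1 < y) \<tau>). y = 1"
    using sorted pos
  proof (induction \<tau>)
    case (Cons y \<tau>)
    show ?case
    proof (cases "1 < y")
      case False
      with Cons.prems have "y = 1" by auto
      with Cons.prems show ?thesis by (auto intro: le_antisym simp: Suc_le_eq)
    qed (use Cons in simp)
  qed simp
  then have "dropWhile (\<lambda>y. 1 < y) \<tau> = replicate (length (dropWhile (\<lambda>y. 1 < y) \<tau>)) 1"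
    by (simp add: replicate_length_same)
  moreover have "length \<rho> + length (dropWhile (\<lambda>y. 1 < y) \<tau>) = L"
    unfolding \<rho>_def len\<tau>[symmetric] length_append[symmetric] by simp
  ultimately have "\<tau> = \<rho> @ replicate (L - length \<sigma>) 1"
    unfolding \<sigma>_def \<rho>_def by (metis add_diff_cancel_left' length_map takeWhile_dropWhile_id)
  moreover have "map Suc \<sigma> = \<rho>"
    unfolding \<sigma>_def map_map by (rule map_idI) (auto dest: \<rho>_mem)
  ultimately have eq: "\<pi> = add_hook L \<sigma>"
    by (simp add: add_hook_def \<pi> x)
  have "sorted_wrt (\<ge>) \<rho>"
    using sorted by (metis \<rho>_def sorted_wrt_append takeWhile_dropWhile_id)
  then have "sorted_wrt (\<lambda>x y. x - 1 \<ge> y - 1) \<rho>"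
    by (rule sorted_wrt_mono_rel[rotated]) auto
  then have "is_partition \<sigma>"
    by (auto simp: is_partition_def \<sigma>_def sorted_wrt_map dest: \<rho>_mem)
  moreover have "largest_part \<sigma> \<le> L"
    using le by (auto simp: largest_part_le_iff \<sigma>_def dest!: \<rho>_mem)
  moreover have "prod.swap ` young_diagram \<sigma> = young_diagram \<sigma>"
    using assms(1) swap_young_diagram_add_hook_iff[OF len\<sigma>] by (simp add: SCP_iff eq)
  ultimately show thesis
    by (intro that[OF _ _ eq]) (simp_all add: SCP_iff)
qed

lemma add_hook_inj:
  assumes "length \<pi> \<le> L" "length \<sigma> \<le> L" "is_partition \<pi>" "is_partition \<sigma>"
    and "add_hook L \<pi> = add_hook L \<sigma>"
  shows "\<pi> = \<sigma>"
proof (rule young_diagram_inj)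
  show "young_diagram \<pi> = young_diagram \<sigma>"
    using shift_mem_young_diagram_add_hook[OF assms(1)]
      shift_mem_young_diagram_add_hook[OF assms(2)]
    unfolding assms(5) by (simp only: set_eq_iff split_paired_All simp_thms)
qed (fact assms)+

section \<open>The generating function\<close>

lemma GSC_2_eq:
  "GSC L 2 (of_int k) q =
     (\<Sum>\<pi> | \<pi> \<in> SCP \<and> bg_rank (young_diagram \<pi>) = k \<and> largest_part \<pi> \<le> L. q ^ sum_list \<pi>)"
  by (simp add: GSC_def GBG_2)

lemma GSC_2_0: "GSC 0 2 (of_int k) q = (if k = 0 then 1 else 0)"
proof -
  have "\<pi> = []" if "\<pi> \<in> SCP" "largest_part \<pi> \<le> 0" for \<pi>
    using length_eq_largest_part[of \<pi>] that by simp
  moreover have "young_diagram [] = {}" by (auto simp: young_diagram_def)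
  then have "[] \<in> SCP" "largest_part [] = 0" "bg_rank (young_diagram []) = 0"
    by (simp_all add: SCP_iff is_partition_def largest_part_def bg_rank_def)
  ultimately have eq: "{\<pi>. \<pi> \<in> SCP \<and> bg_rank (young_diagram \<pi>) = k \<and> largest_part \<pi> \<le> 0} =
      {\<pi>. \<pi> = [] \<and> k = 0}"
    by (intro Collect_cong) (metis order_refl)
  show ?thesis unfolding GSC_2_eq eq by (cases "k = 0") simp_all
qed

lemma GSC_2_Suc:
  "GSC (Suc L) 2 (of_int k) q =
     GSC L 2 (of_int k) q + q ^ (2 * L + 1) * GSC L 2 (of_int (k - (- 1) ^ L)) q"
proof -
  define A where "A M k = {\<pi>. \<pi> \<in> SCP \<and> bg_rank (young_diagram \<pi>) = k \<and> largest_part \<pi> \<le> M}"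
    for M k
  have GSC: "GSC M 2 (of_int k) q = (\<Sum>\<pi>\<in>A M k. q ^ sum_list \<pi>)" for M k
    by (simp add: GSC_2_eq A_def)
  have fin: "finite (A M k)" for M k
    by (rule finite_subset[OF _ finite_SCP_bounded[of M]]) (auto simp: A_def)
  have len: "length \<pi> \<le> M" if "\<pi> \<in> A M k" for \<pi> M k
    using that length_eq_largest_part by (auto simp: A_def)
  \<comment> \<open>The cases are largest part at most \<open>L\<close> and exactly
    \<open>Suc L\<close>; in the latter, subtracting \<open>(- 1) ^ L\<close> removes the
    contribution of the hook to the rank.\<close>
  have split: "A (Suc L) k = A L k \<union> add_hook L ` A L (k - (- 1) ^ L)" (is "?l = ?r")
  proof (intro equalityI subsetI)
    fix \<pi> assume \<pi>: "\<pi> \<in> ?l"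
    show "\<pi> \<in> ?r"
    proof (cases "largest_part \<pi> \<le> L")
      case True
      with \<pi> show ?thesis by (simp add: A_def)
    next
      case False
      with \<pi> have "\<pi> \<in> SCP" "largest_part \<pi> = Suc L" by (auto simp: A_def)
      then obtain \<sigma> where \<sigma>: "\<sigma> \<in> SCP" "largest_part \<sigma> \<le> L" "\<pi> = add_hook L \<sigma>"
        by (rule add_hook_surj)
      then have "length \<sigma> \<le> L" using length_eq_largest_part by simp
      with \<pi> \<sigma> have "\<sigma> \<in> A L (k - (- 1) ^ L)" by (auto simp: A_def bg_rank_add_hook)
      with \<sigma> show ?thesis by simp
    qed
  next
    fix \<pi> assume "\<pi> \<in> ?r"
    then show "\<pi> \<in> ?l"
      using len add_hook_in_SCP by (auto simp: A_def bg_rank_add_hook)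
  qed
  have disj: "A L k \<inter> add_hook L ` A L (k - (- 1) ^ L) = {}"
    using add_hook_in_SCP(2) by (auto simp: A_def)
  have inj: "inj_on (add_hook L) (A L k)" for k
    by (rule inj_onI, rule add_hook_inj, (erule len)+) (simp_all add: A_def SCP_iff)
  have "(\<Sum>\<pi>\<in>add_hook L ` A L k. q ^ sum_list \<pi>) =
      q ^ (2 * L + 1) * (\<Sum>\<pi>\<in>A L k. q ^ sum_list \<pi>)" for k
    unfolding sum.reindex[OF inj] sum_distrib_left
    by (intro sum.cong refl) (simp only: comp_apply sum_list_add_hook[OF len] power_add)
  then show ?thesis
    unfolding GSC split by (subst sum.union_disjoint) (use fin disj in auto)
qed

text \<open>Writing \<open>L div 2\<close> for \<open>N\<close> covers both parities in one
  statement, so that the induction can raise \<open>L\<close> by one.\<close>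

lemma GSC_2_fps_X:
  "GSC L 2 (of_int k) (fps_X :: 'a :: field fps) =
     fps_X ^ nat (2 * k ^ 2 - k) * q_binomial (int L) (int (L div 2) + k) (fps_X ^ 4)"
proof (induction L arbitrary: k)
  case 0
  then show ?case by (auto simp: GSC_2_0 q_binomial_def q_pochhammer_def)
next
  case (Suc L)
  let ?X = "fps_X :: 'a fps"
  have X: "fps_nth (?X ^ 4) 0 = 0" by simp
  \<comment> \<open>Reduces the matching of powers to an integer identity. The exponent
    \<open>e\<close> has to be non-negative only where the coefficient can be nonzero; elsewhere
    both sides are 0.\<close>
  have exp: "?X ^ (2 * L + 1) * (?X ^ nat (2 * l ^ 2 - l) * q_binomial (int L) n (?X ^ 4)) =
      ?X ^ nat (2 * k ^ 2 - k) * ((?X ^ 4) ^ nat e * q_binomial (int L) n (?X ^ 4))"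
    if "2 * int L + 1 + (2 * l ^ 2 - l) = 2 * k ^ 2 - k + 4 * e" "0 \<le> n \<Longrightarrow> n \<le> int L \<Longrightarrow> 0 \<le> e"
    for l n e
  proof (cases "0 \<le> n \<and> n \<le> int L")
    case True
    then have "int (2 * L + 1 + nat (2 * l ^ 2 - l)) = int (nat (2 * k ^ 2 - k) + 4 * nat e)"
      using that exponent_nonneg[of l] exponent_nonneg[of k] by simp
    then have "2 * L + 1 + nat (2 * l ^ 2 - l) = nat (2 * k ^ 2 - k) + 4 * nat e"
      by (simp only: of_nat_eq_iff)
    then have "?X ^ (2 * L + 1) * ?X ^ nat (2 * l ^ 2 - l) =
        ?X ^ nat (2 * k ^ 2 - k) * (?X ^ 4) ^ nat e"
      by (simp only: flip: power_add power_mult)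
    then show ?thesis by (simp only: flip: mult.assoc)
  qed (auto simp: q_binomial_def)
  show ?case
  proof (cases "even L")
    case True
    then obtain N where N: "L = 2 * N" by auto
    have "GSC (Suc L) 2 (of_int k) ?X = GSC L 2 (of_int k) ?X +
        ?X ^ (2 * L + 1) * GSC L 2 (of_int (k - 1)) ?X"
      using GSC_2_Suc[of L k ?X] True by simp
    \<comment> \<open>Replacing \<open>k\<close> by \<open>k - 1\<close> lowers
      \<open>2 * k ^ 2 - k\<close> by \<open>4 * k - 3\<close>; with the hook size
      \<open>4 * N + 1\<close> this leaves \<open>4 * (N + 1 - k)\<close>.\<close>
    also have "\<dots> = ?X ^ nat (2 * k ^ 2 - k) * (q_binomial (int L) (int N + k) (?X ^ 4) +
        (?X ^ 4) ^ nat (int L + 1 - (int N + k)) * q_binomial (int L) (int N + k - 1) (?X ^ 4))"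
      unfolding Suc.IH by (subst exp[of _ "int L + 1 - (int N + k)"])
        (auto simp: N power2_eq_square algebra_simps)
    finally show ?thesis
      unfolding q_binomial_pascal[OF X, symmetric] by (simp add: N)
  next
    case False
    then obtain N where N: "L = 2 * N + 1" by (auto elim: oddE)
    have "GSC (Suc L) 2 (of_int k) ?X = GSC L 2 (of_int k) ?X +
        ?X ^ (2 * L + 1) * GSC L 2 (of_int (k + 1)) ?X"
      using GSC_2_Suc[of L k ?X] False by simp
    \<comment> \<open>Now \<open>Suc L div 2\<close> is \<open>N + 1\<close> while
      \<open>L div 2\<close> is \<open>N\<close>, so the unshifted term carries the lower index
      \<open>N + 1 + k - 1\<close>. The exponent comes from
      \<open>(4 * N + 3) + (4 * k + 1) = 4 * (N + 1 + k)\<close>.\<close>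
    also have "\<dots> = ?X ^ nat (2 * k ^ 2 - k) * (q_binomial (int L) (int N + 1 + k - 1) (?X ^ 4) +
        (?X ^ 4) ^ nat (int N + 1 + k) * q_binomial (int L) (int N + 1 + k) (?X ^ 4))"
      unfolding Suc.IH by (subst exp[of _ "int N + 1 + k"])
        (auto simp: N power2_eq_square algebra_simps)
    finally show ?thesis
      unfolding q_binomial_pascal'[OF X, symmetric] by (simp add: N algebra_simps)
  qed
qed

theorem theorem1p2:
  fixes N \<nu> :: nat and k :: int
  assumes "\<nu> \<in> {0, 1}"
  shows "GSC (2 * N + \<nu>) 2 (of_int k) (fps_X :: rat fps) =
           fps_X ^ nat (2 * k ^ 2 - k) * q_binomial (int (2 * N + \<nu>)) (int N + k) (fps_X ^ 4)"
proof -
  have "(2 * N + \<nu>) div 2 = N" using assms by auto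
  then show ?thesis using GSC_2_fps_X[of "2 * N + \<nu>" k] by simp
qed

end
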